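(* Let $A_1,\dots,A_d$ be $n\times n$ real matrices. If $N\times N$ commuting extensions of $A_1,\dots,A_d$ exist, then $$N\ge n+\frac12\max_{i,j}\operatorname{rank}([A_i,A_j]),$$ where $[A_i,A_j]=A_iA_j-A_jA_i$.
   Context: $N\times N$ matrices $\tilde A_1,\dots,\tilde A_d$ are $N\times N$ commuting extensions of the $n\times n$ matrices $A_1,\dots,A_d$ ($N\ge n$) if the top left $n\times n$ block of $\tilde A_i$ is $A_i$ for each $i=1,\dots,d$, and the matrices $\tilde A_1,\dots,\tilde A_d$ pairwise commute. *)

theory Defs
  imports Complex_Main "Jordan_Normal_Form.DL_Rank"
begin

definition commutator :: "'a::ring mat \<Rightarrow> 'a mat \<Rightarrow> 'a mat" where
  "commutator A B = A * B - B * A"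

text \<open>The top left \<open>n \<times> n\<close> block is the first component of \<open>split_block _ n n\<close>.
  Families of \<open>d\<close> matrices are functions on indices, relevant only on \<open>{1..d}\<close>.\<close>

definition commuting_extensions ::
  "nat \<Rightarrow> nat \<Rightarrow> nat \<Rightarrow> (nat \<Rightarrow> 'a::semiring_0 mat) \<Rightarrow> (nat \<Rightarrow> 'a mat) \<Rightarrow> bool" where
  "commuting_extensions d n N A A' \<longleftrightarrow>
     n \<le> N \<and>
     (\<forall>i\<in>{1..d}. A' i \<in> carrier_mat N N) \<and>
     (\<forall>i\<in>{1..d}. fst (split_block (A' i) n n) = A i) \<and>
     (\<forall>i\<in>{1..d}. \<forall>j\<in>{1..d}. A' i * A' j = A' j * A' i)"

end

(* Writing the extensions in blocks as A'_i = (A_i, B_i; C_i, D_i), the top left blocks of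
   A'_i A'_j = A'_j A'_i give [A_i, A_j] = B_j C_i - B_i C_j. Both products factor through a space of
   dimension N - n, so the commutator has rank at most 2 (N - n). *)
theory Submission
  imports Defs
begin

text \<open>The product is the sum of \<open>m\<close> outer products, column \<open>k\<close> of
  \<open>B\<close> times row \<open>k\<close> of \<open>C\<close>. Each has rank at most 1, and rank
  is subadditive.\<close>

lemma (in vec_space) rank_mult_le_inner_dim:
  assumes "B \<in> carrier_mat n m" and "C \<in> carrier_mat m nc"
  shows "rank (B * C) \<le> m"
proof -
  \<comment> \<open>Induction over the partial sums of outer products. The bound holds for every
    \<open>l\<close>, even beyond \<open>m\<close>: it only uses that each summand is a function of
    \<open>r\<close> times a function of \<open>c\<close>, whatever values out-of-range entries
    have.\<close>
  have "rank (mat n nc (\<lambda>(r, c). \<Sum>k<l. B $$ (r, k) * C $$ (k, c))) \<le> l" for l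
  proof (induction l)
    case 0
    have "mat n nc (\<lambda>(r, c). \<Sum>k<0::nat. B $$ (r, k) * C $$ (k, c)) = 0\<^sub>m n nc"
      by (rule eq_matI) auto
    then show ?case by (metis rank_0I order_refl)
  next
    case (Suc l)
    let ?S = "\<lambda>l. mat n nc (\<lambda>(r, c). \<Sum>k<l. B $$ (r, k) * C $$ (k, c))"
    let ?P = "mat n nc (\<lambda>(r, c). B $$ (r, l) * C $$ (l, c))"
    have "rank (?S (Suc l)) = rank (?S l + ?P)"
      by (rule arg_cong[where f = rank], rule eq_matI) auto
    also have "\<dots> \<le> rank (?S l) + rank ?P"
      by (rule rank_subadditive) auto
    also have "rank ?P \<le> 1"
      by (rule rank_le_1_product_entries[where nc = nc]) auto
    finally show ?case using Suc.IH by simp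
  qed
  moreover have "B * C = mat n nc (\<lambda>(r, c). \<Sum>k<m. B $$ (r, k) * C $$ (k, c))"
    using assms by (intro eq_matI) (auto simp: scalar_prod_def atLeast0LessThan)
  ultimately show ?thesis by simp
qed

text \<open>Equality of the top left blocks of the two products reads
  \<open>A1 * A2 + B1 * C2 = A2 * A1 + B2 * C1\<close>. The sign is moved onto \<open>B1\<close> so
  that the right-hand side is a sum of two products, ready for subadditivity of rank.\<close>

lemma commutator_eq_of_commuting_blocks:
  fixes A1 :: "'a::ring mat"
  assumes c1: "A1 \<in> carrier_mat n n" "B1 \<in> carrier_mat n m"
      "C1 \<in> carrier_mat m n" "D1 \<in> carrier_mat m m"
    and c2: "A2 \<in> carrier_mat n n" "B2 \<in> carrier_mat n m"
      "C2 \<in> carrier_mat m n" "D2 \<in> carrier_mat m m"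
    and comm: "four_block_mat A1 B1 C1 D1 * four_block_mat A2 B2 C2 D2
      = four_block_mat A2 B2 C2 D2 * four_block_mat A1 B1 C1 D1"
  shows "commutator A1 A2 = B2 * C1 + (- B1) * C2"
proof (rule eq_matI)
  fix r c
  assume "r < dim_row (B2 * C1 + (- B1) * C2)" "c < dim_col (B2 * C1 + (- B1) * C2)"
  then have rc: "r < n" "c < n" using c1 c2 by auto
  have "four_block_mat (A1 * A2 + B1 * C2) (A1 * B2 + B1 * D2) (C1 * A2 + D1 * C2) (C1 * B2 + D1 * D2)
      = four_block_mat (A2 * A1 + B2 * C1) (A2 * B1 + B2 * D1) (C2 * A1 + D2 * C1) (C2 * B1 + D2 * D1)"
    using comm unfolding mult_four_block_mat[OF c1 c2] mult_four_block_mat[OF c2 c1] .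
  \<comment> \<open>For \<open>r, c < n\<close> the entry lies in the top left block, so the other
    three blocks drop out.\<close>
  from arg_cong[OF this, where f = "\<lambda>M. M $$ (r, c)"]
  have "(A1 * A2) $$ (r, c) + (B1 * C2) $$ (r, c) = (A2 * A1) $$ (r, c) + (B2 * C1) $$ (r, c)"
    using rc c1 c2 by simp
  then have "(A1 * A2) $$ (r, c) - (A2 * A1) $$ (r, c) = (B2 * C1) $$ (r, c) - (B1 * C2) $$ (r, c)"
    by (simp add: algebra_simps)
  moreover have "(- B1) * C2 = - (B1 * C2)"
    using c1 c2 by (intro uminus_mult_left_mat) auto
  ultimately show "commutator A1 A2 $$ (r, c) = (B2 * C1 + (- B1) * C2) $$ (r, c)"
    using rc c1 c2 by (simp add: commutator_def)
qed (use c1 c2 in \<open>auto simp: commutator_def\<close>)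

lemma rank_commutator_le:
  fixes A A' :: "nat \<Rightarrow> 'a::field mat"
  assumes ext: "commuting_extensions d n N A A'" and i: "i \<in> {1..d}" and j: "j \<in> {1..d}"
  shows "vec_space.rank n (commutator (A i) (A j)) \<le> 2 * (N - n)"
proof -
  interpret vec_space "TYPE('a)" n .
  let ?m = "N - n"
  have nN: "n \<le> N" using ext by (simp add: commuting_extensions_def)
  \<comment> \<open>Here the condition on \<open>split_block\<close> becomes an explicit block form.
    The sizes fit because \<open>n \<le> N\<close> gives \<open>N = n + (N - n)\<close>.\<close>
  have blocks: "\<exists>B C D. A k \<in> carrier_mat n n \<and> B \<in> carrier_mat n ?m \<and> C \<in> carrier_mat ?m n \<and>
      D \<in> carrier_mat ?m ?m \<and> A' k = four_block_mat (A k) B C D" if "k \<in> {1..d}" for k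
  proof -
    obtain A0 B C D where s: "split_block (A' k) n n = (A0, B, C, D)"
      by (metis prod_cases4)
    have "fst (split_block (A' k) n n) = A k" and A': "A' k \<in> carrier_mat N N"
      using ext that unfolding commuting_extensions_def by blast+
    then have A0: "A0 = A k"
      unfolding s by simp
    have dims: "dim_row (A' k) = n + ?m" "dim_col (A' k) = n + ?m"
      using A' nN by simp_all
    show ?thesis
      using split_block[OF s dims] unfolding A0
      by (intro exI[of _ B] exI[of _ C] exI[of _ D] conjI)
  qed
  obtain B1 C1 D1 where 1: "A i \<in> carrier_mat n n" "B1 \<in> carrier_mat n ?m" "C1 \<in> carrier_mat ?m n"
      "D1 \<in> carrier_mat ?m ?m" and A1: "A' i = four_block_mat (A i) B1 C1 D1"
    using blocks[OF i] by blast
  obtain B2 C2 D2 where 2: "A j \<in> carrier_mat n n" "B2 \<in> carrier_mat n ?m" "C2 \<in> carrier_mat ?m n"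
      "D2 \<in> carrier_mat ?m ?m" and A2: "A' j = four_block_mat (A j) B2 C2 D2"
    using blocks[OF j] by blast
  have "A' i * A' j = A' j * A' i"
    using ext i j by (auto simp: commuting_extensions_def)
  then have "commutator (A i) (A j) = B2 * C1 + (- B1) * C2"
    unfolding A1 A2 by (rule commutator_eq_of_commuting_blocks[OF 1 2])
  also have "rank \<dots> \<le> rank (B2 * C1) + rank ((- B1) * C2)"
    using 1 2 by (intro rank_subadditive) auto
  \<comment> \<open>Both products have inner dimension \<open>N - n\<close>.\<close>
  also have "\<dots> \<le> ?m + ?m"
    using 1 2 by (intro add_mono rank_mult_le_inner_dim) auto
  finally show ?thesis by simp
qed

theorem theorem2:
  fixes A :: "nat \<Rightarrow> real mat" and d n N :: nat
  assumes "1 \<le> d"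
    and "\<And>i. i \<in> {1..d} \<Longrightarrow> A i \<in> carrier_mat n n"
    and "\<exists>A'. commuting_extensions d n N A A'"
  shows "real N \<ge> real n +
    1 / 2 * real (MAX (i, j) \<in> {1..d} \<times> {1..d}. vec_space.rank n (commutator (A i) (A j)))"
proof -
  obtain A' where ext: "commuting_extensions d n N A A'"
    using assms(3) by blast
  let ?r = "\<lambda>(i, j). vec_space.rank n (commutator (A i) (A j))"
  define R where "R = Max (?r ` ({1..d} \<times> {1..d}))"
  have "?r p \<le> 2 * (N - n)" if "p \<in> {1..d} \<times> {1..d}" for p
  proof -
    obtain i j where p: "p = (i, j)"
      by (cases p)
    show ?thesis
      unfolding p prod.case using that[unfolded p] by (intro rank_commutator_le[OF ext]) simp_all
  qed
  \<comment> \<open>\<open>Max\<close> is bounded by its elements only over a nonempty set; this is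
    where \<open>1 \<le> d\<close> enters.\<close>
  moreover have "{1..d} \<times> {1..d} \<noteq> {}"
    using \<open>1 \<le> d\<close> by simp
  ultimately have "R \<le> 2 * (N - n)"
    unfolding R_def by (subst Max_le_iff) blast+
  then have "real R \<le> real (2 * (N - n))"
    by (rule of_nat_mono)
  \<comment> \<open>This makes the truncated subtraction \<open>N - n\<close> agree with the real
    difference.\<close>
  moreover have "n \<le> N"
    using ext by (simp add: commuting_extensions_def)
  ultimately have "real R \<le> 2 * (real N - real n)"
    by (simp add: of_nat_diff)
  then show ?thesis
    unfolding R_def[symmetric] by (simp add: field_simps)
qed

end
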